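(* Let $f \in C(\mathbb{T})$, let $(n_j)_{j}$ be a strictly increasing sequence in $\mathbb{N}$, let $A \subset \mathbb{T}$, and suppose that $(s_{n_j} f)_j$ converges pointwise on $A$ to some function $h : A \to \mathbb{C}$. Then $h$ differs from $f$ at most on a set of first category, i.e. $\{ t \in A : h(t) \neq f(t)\}$ is of first category in $\mathbb{T}$.
   Context: $\mathbb{T} = \mathbb{R}/2\pi\mathbb{Z}$ is the unit circle. $C(\mathbb{T})$ is the space of continuous functions $f : \mathbb{T} \to \mathbb{C}$. For $f \in C(\mathbb{T})$ and $n \in \mathbb{N}$, $s_n f$ denotes the $n$-th partial sum of the Fourier series of $f$, i.e. $(s_n f)(t) = \sum_{k=-n}^{n} \hat f(k) e^{ikt}$ with $\hat f(k) = \frac{1}{2\pi}\int_{\mathbb{T}} f(s) e^{-iks}\,ds$. A set is of first category in $\mathbb{T}$ if it is a countable union of nowhere dense subsets of $\mathbb{T}$. *)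

theory Defs
  imports "HOL-Analysis.Analysis"
begin

quotient_type circle = real / "\<lambda>x y :: real. \<exists>k::int. x - y = 2 * pi * of_int k"
  morphisms rep_circle circle_of
proof (rule equivpI)
  show "reflp (\<lambda>x y :: real. \<exists>k::int. x - y = 2 * pi * of_int k)"
    by (rule reflpI, rule exI[of _ 0]) simp
  show "symp (\<lambda>x y :: real. \<exists>k::int. x - y = 2 * pi * of_int k)"
  proof (rule sympI)
    fix x y :: real
    assume "\<exists>k::int. x - y = 2 * pi * of_int k"
    then obtain k :: int where "x - y = 2 * pi * of_int k" ..
    then have "y - x = 2 * pi * of_int (- k)" by simp
    then show "\<exists>k::int. y - x = 2 * pi * of_int k" ..
  qed
  show "transp (\<lambda>x y :: real. \<exists>k::int. x - y = 2 * pi * of_int k)"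
  proof (rule transpI)
    fix x y z :: real
    assume "\<exists>k::int. x - y = 2 * pi * of_int k" "\<exists>k::int. y - z = 2 * pi * of_int k"
    then obtain k l :: int where "x - y = 2 * pi * of_int k" "y - z = 2 * pi * of_int l" by blast
    then have "x - z = 2 * pi * of_int (k + l)" by (simp add: distrib_left)
    then show "\<exists>k::int. x - z = 2 * pi * of_int k" ..
  qed
qed

instantiation circle :: topological_space
begin

definition open_circle :: "circle set \<Rightarrow> bool"
  where "open_circle U \<longleftrightarrow> open (circle_of -` U)"

instance
proof
  show "open (UNIV :: circle set)"
    by (simp add: open_circle_def)
  show "open (S \<inter> T)" if "open S" "open T" for S T :: "circle set"
    using that by (simp add: open_circle_def open_Int)
  show "open (\<Union>K)" if "\<forall>S\<in>K. open S" for K :: "circle set set"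
    using that by (auto simp: open_circle_def vimage_Union)
qed

end

lift_definition circle_exp :: "int \<Rightarrow> circle \<Rightarrow> complex"
  is "\<lambda>k t. exp (\<i> * of_int k * of_real t)"
proof -
  fix k :: int and x y :: real
  assume "\<exists>m::int. x - y = 2 * pi * of_int m"
  then obtain m :: int where "x - y = 2 * pi * of_int m" ..
  then have "x = y + 2 * pi * of_int m" by simp
  then have "\<i> * of_int k * of_real x =
      \<i> * of_int k * of_real y + (of_int (2 * (k * m)) * pi) * \<i>"
    by (simp add: algebra_simps)
  then show "exp (\<i> * of_int k * of_real x) = exp (\<i> * of_int k * of_real y)"
    unfolding exp_eq by blast
qed

text \<open>The integral over the circle is taken over the fundamental domain from 0 to 2 pi.\<close>

definition fourier_coeff :: "(circle \<Rightarrow> complex) \<Rightarrow> int \<Rightarrow> complex"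
  where "fourier_coeff f k =
    1 / (2 * of_real pi) * integral {0..2 * pi} (\<lambda>s. f (circle_of s) * circle_exp (- k) (circle_of s))"

definition fourier_partial_sum :: "nat \<Rightarrow> (circle \<Rightarrow> complex) \<Rightarrow> circle \<Rightarrow> complex"
  where "fourier_partial_sum n f t =
    (\<Sum>k = - int n..int n. fourier_coeff f k * circle_exp k t)"

definition nowhere_dense :: "'a::topological_space set \<Rightarrow> bool"
  where "nowhere_dense S \<longleftrightarrow> interior (closure S) = {}"

definition first_category :: "'a::topological_space set \<Rightarrow> bool"
  where "first_category S \<longleftrightarrow>
    (\<exists>F. countable F \<and> (\<forall>N\<in>F. nowhere_dense N) \<and> S = \<Union>F)"

end

theory Submission
  imports Defs
begin

text \<open>
  The Fourier series of a continuous function \<open>f\<close> converges to \<open>f\<close> in mean square, and this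
  forbids the partial sums from staying away from \<open>f\<close> on an arc.

  If \<open>h t \<noteq> f t\<close>, then along the subsequence the error \<open>\<bar>f t - s\<^sub>n f t\<bar>\<close> is eventually at least
  some \<open>1 / (m + 1)\<close>. So the exceptional set is covered by the countably many sets of points at
  which the error is at least \<open>1 / (m + 1)\<close> from the index \<open>N\<close> on. Each of these is closed, because
  \<open>f\<close> and its partial sums are continuous, and it contains no arc, because an arc would keep the
  mean square error away from 0; hence it is nowhere dense (\<open>nowhere_dense_subsequence_bad\<close>).

  Mean square convergence (\<open>fourier_mean_square_convergence\<close>) follows from two facts:
  trigonometric polynomials are uniformly dense in the continuous functions
  (\<open>trig_polynomial_approx\<close>, the Stone-Weierstrass theorem on the compact Hausdorff space
  \<open>circle\<close>), and the remainder \<open>g - s\<^sub>n g\<close> is never larger than \<open>g\<close> in mean square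
  (\<open>fourier_remainder_le\<close>, orthogonality). The latter is applied to \<open>g = f - p\<close>, where \<open>p\<close> is a
  trigonometric polynomial close to \<open>f\<close>: once \<open>n\<close> reaches the degree of \<open>p\<close>, \<open>f\<close> and \<open>g\<close> have the
  same remainder.
\<close>

section \<open>The circle as a compact Hausdorff space\<close>

lemma continuous_on_circle_iff:
  fixes g :: "circle \<Rightarrow> 'a::topological_space"
  shows "continuous_on UNIV g \<longleftrightarrow> continuous_on UNIV (\<lambda>s. g (circle_of s))"
  by (simp add: continuous_on_open_vimage open_circle_def vimage_def)

lemma continuous_on_circle_of: "continuous_on S circle_of"
proof -
  have "continuous_on UNIV circle_of"
    by (simp add: continuous_on_open_vimage open_circle_def)
  then show ?thesis
    by (rule continuous_on_subset) simp
qed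

lemma circle_of_add_period [simp]: "circle_of (s + 2 * pi * of_int k) = circle_of s"
  by (subst circle.abs_eq_iff) (rule exI[of _ k], simp)

lemma circle_of_cases:
  obtains s where "t = circle_of s"
  using Quotient3_abs_rep[OF Quotient3_circle, of t] by metis

lemma continuous_circle_exp: "continuous_on UNIV (circle_exp k)"
  unfolding continuous_on_circle_iff circle_exp.abs_eq by (intro continuous_intros)

lemma inj_circle_exp_1: "inj (circle_exp 1)"
proof (rule injI)
  fix x y
  assume eq: "circle_exp 1 x = circle_exp 1 y"
  obtain a where a: "x = circle_of a"
    by (rule circle_of_cases)
  obtain b where b: "y = circle_of b"
    by (rule circle_of_cases)
  have "exp (\<i> * of_real a) = exp (\<i> * of_real b)"
    using eq by (simp add: a b circle_exp.abs_eq)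
  then obtain m :: int where "\<i> * of_real a = \<i> * of_real b + of_int (2 * m) * of_real pi * \<i>"
    unfolding exp_eq by auto
  then have "Im (\<i> * of_real a) = Im (\<i> * of_real b + of_int (2 * m) * of_real pi * \<i>)"
    by simp
  then have "a = b + 2 * pi * of_int m"
    by simp
  then show "x = y"
    by (simp add: a b)
qed

text \<open>The injective continuous function \<open>circle_exp 1\<close> pulls the separation of points back from
  the complex plane. The Stone-Weierstrass theorem is stated for Hausdorff spaces.\<close>

instance circle :: t2_space
proof
  fix x y :: circle
  assume "x \<noteq> y"
  then have "circle_exp 1 x \<noteq> circle_exp 1 y"
    using inj_circle_exp_1 by (simp add: inj_eq)
  from hausdorff[OF this] obtain U V
    where UV: "open U" "open V" "circle_exp 1 x \<in> U" "circle_exp 1 y \<in> V" "U \<inter> V = {}"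
    by blast
  have "open (circle_exp 1 -` U)" "open (circle_exp 1 -` V)"
    using UV continuous_circle_exp by (auto simp: continuous_on_open_vimage)
  with UV show "\<exists>U V. open U \<and> open V \<and> x \<in> U \<and> y \<in> V \<and> U \<inter> V = {}"
    by (intro exI[of _ "circle_exp 1 -` U"] exI[of _ "circle_exp 1 -` V"]) auto
qed

lemma circle_of_shift:
  obtains y where "circle_of y = circle_of x" "0 \<le> y" "y < 2 * pi"
proof
  define y where "y = x + 2 * pi * of_int (- \<lfloor>x / (2 * pi)\<rfloor>)"
  have "y = 2 * pi * frac (x / (2 * pi))"
    by (simp add: y_def frac_def field_simps)
  then show "0 \<le> x + 2 * pi * of_int (- \<lfloor>x / (2 * pi)\<rfloor>)"
    "x + 2 * pi * of_int (- \<lfloor>x / (2 * pi)\<rfloor>) < 2 * pi"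
    using frac_lt_1[of "x / (2 * pi)"] unfolding y_def by auto
qed (rule circle_of_add_period)

lemma compact_circle: "compact (UNIV :: circle set)"
proof -
  have "compact (circle_of ` {0..2 * pi})"
    by (intro compact_continuous_image continuous_on_circle_of compact_Icc)
  moreover have "t \<in> circle_of ` {0..2 * pi}" for t
  proof -
    obtain x where "t = circle_of x"
      by (rule circle_of_cases)
    moreover obtain y where "circle_of y = circle_of x" "0 \<le> y" "y < 2 * pi"
      by (rule circle_of_shift)
    ultimately show ?thesis
      by (intro image_eqI[of _ _ y]) auto
  qed
  then have "circle_of ` {0..2 * pi} = UNIV"
    by auto
  ultimately show ?thesis
    by simp
qed

section \<open>Trigonometric polynomials\<close>

text \<open>Generating the trigonometric polynomials from monomials by addition leaves out the degree,
  so that closure under products needs no reindexing of double sums.\<close>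

inductive trig_polynomial :: "(circle \<Rightarrow> complex) \<Rightarrow> bool" where
  monomial: "trig_polynomial (\<lambda>t. c * circle_exp k t)"
| add: "trig_polynomial p \<Longrightarrow> trig_polynomial q \<Longrightarrow> trig_polynomial (\<lambda>t. p t + q t)"

lemma circle_exp_add: "circle_exp (k + l) t = circle_exp k t * circle_exp l t"
  by transfer (simp add: exp_add algebra_simps)

lemma circle_exp_0 [simp]: "circle_exp 0 t = 1"
  by transfer simp

lemma cnj_circle_exp: "cnj (circle_exp k t) = circle_exp (- k) t"
  by transfer (simp add: exp_cnj)

lemma trig_polynomial_monomial_mult:
  "trig_polynomial q \<Longrightarrow> trig_polynomial (\<lambda>t. c * circle_exp k t * q t)"
proof (induction rule: trig_polynomial.induct)
  case (monomial d l)
  show ?case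
    using trig_polynomial.monomial[of "c * d" "k + l"] by (simp add: circle_exp_add mult_ac)
next
  case (add p q)
  then show ?case
    using trig_polynomial.add by (fastforce simp: distrib_left)
qed

lemma trig_polynomial_mult:
  "trig_polynomial p \<Longrightarrow> trig_polynomial q \<Longrightarrow> trig_polynomial (\<lambda>t. p t * q t)"
proof (induction rule: trig_polynomial.induct)
  case (monomial d l)
  then show ?case
    by (rule trig_polynomial_monomial_mult)
next
  case (add p p')
  then show ?case
    using trig_polynomial.add by (fastforce simp: distrib_right)
qed

lemma trig_polynomial_const: "trig_polynomial (\<lambda>t. c)"
  using trig_polynomial.monomial[of c 0] by simp

lemma continuous_trig_polynomial: "trig_polynomial p \<Longrightarrow> continuous_on UNIV p"
  by (induction rule: trig_polynomial.induct) (intro continuous_intros continuous_circle_exp; assumption)+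

lemma trig_polynomial_Re_exp: "trig_polynomial (\<lambda>t. of_real (Re (circle_exp k t)))"
proof -
  have "complex_of_real (Re z) = 1 / 2 * z + 1 / 2 * cnj z" for z
    by (simp add: complex_eq_iff)
  then show ?thesis
    using trig_polynomial.add[OF trig_polynomial.monomial trig_polynomial.monomial,
        of "1 / 2" k "1 / 2" "- k"] by (simp only: cnj_circle_exp)
qed

lemma trig_polynomial_Im_exp: "trig_polynomial (\<lambda>t. of_real (Im (circle_exp k t)))"
proof -
  have "complex_of_real (Im z) = (- \<i> / 2) * z + (\<i> / 2) * cnj z" for z
    by (simp add: complex_eq_iff)
  then show ?thesis
    using trig_polynomial.add[OF trig_polynomial.monomial trig_polynomial.monomial,
        of "- \<i> / 2" k "\<i> / 2" "- k"] by (simp only: cnj_circle_exp)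
qed

text \<open>The real-valued trigonometric polynomials form an algebra, and they separate points because
  the real and imaginary parts of \<open>circle_exp 1\<close> are among them.\<close>

lemma trig_polynomial_approx_real:
  fixes g :: "circle \<Rightarrow> real"
  assumes "continuous_on UNIV g" "0 < e"
  obtains r where "trig_polynomial (\<lambda>t. of_real (r t))" "\<And>t. \<bar>g t - r t\<bar> < e"
proof -
  have "\<exists>r. trig_polynomial (\<lambda>t. complex_of_real (r t)) \<and> (\<forall>t\<in>UNIV. \<bar>g t - r t\<bar> < e)"
  proof (rule Stone_Weierstrass_HOL[where P = "\<lambda>r. trig_polynomial (\<lambda>t. complex_of_real (r t))"])
    fix r :: "circle \<Rightarrow> real"
    assume "trig_polynomial (\<lambda>t. complex_of_real (r t))"
    from continuous_on_Re[OF continuous_trig_polynomial[OF this]]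
    show "continuous_on UNIV r" by simp
  next
    fix x y :: circle
    assume "x \<in> UNIV \<and> y \<in> UNIV \<and> x \<noteq> y"
    then have "circle_exp 1 x \<noteq> circle_exp 1 y"
      using inj_circle_exp_1 by (simp add: inj_eq)
    then consider "Re (circle_exp 1 x) \<noteq> Re (circle_exp 1 y)" | "Im (circle_exp 1 x) \<noteq> Im (circle_exp 1 y)"
      using complex_eq_iff by blast
    then show "\<exists>r. trig_polynomial (\<lambda>t. complex_of_real (r t)) \<and> r x \<noteq> r y"
    proof cases
      case 1
      with trig_polynomial_Re_exp[of 1] show ?thesis
        by (intro exI[of _ "\<lambda>t. Re (circle_exp 1 t)"]) simp
    next
      case 2
      with trig_polynomial_Im_exp[of 1] show ?thesis
        by (intro exI[of _ "\<lambda>t. Im (circle_exp 1 t)"]) simp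
    qed
  qed (use assms compact_circle in
      \<open>auto intro: trig_polynomial_const trig_polynomial.add trig_polynomial_mult\<close>)
  then show ?thesis
    using that by blast
qed

lemma trig_polynomial_approx:
  assumes "continuous_on UNIV g" "0 < e"
  obtains p where "trig_polynomial p" "\<And>t. norm (g t - p t) < e"
proof -
  have parts: "continuous_on UNIV (\<lambda>t. Re (g t))" "continuous_on UNIV (\<lambda>t. Im (g t))"
    by (intro continuous_intros assms(1))+
  have "0 < e / 2"
    using \<open>0 < e\<close> by simp
  note approx = parts[THEN trig_polynomial_approx_real, OF this]
  obtain u where u: "trig_polynomial (\<lambda>t. of_real (u t))" "\<And>t. \<bar>Re (g t) - u t\<bar> < e / 2"
    using approx(1) by blast
  obtain v where v: "trig_polynomial (\<lambda>t. of_real (v t))" "\<And>t. \<bar>Im (g t) - v t\<bar> < e / 2"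
    using approx(2) by blast
  show ?thesis
  proof
    show "trig_polynomial (\<lambda>t. of_real (u t) + \<i> * of_real (v t))"
      by (intro trig_polynomial.add u trig_polynomial_mult trig_polynomial_const v)
    show "norm (g t - (of_real (u t) + \<i> * of_real (v t))) < e" for t
      using cmod_le[of "g t - (of_real (u t) + \<i> * of_real (v t))"] u(2)[of t] v(2)[of t] by simp
  qed
qed

section \<open>Fourier coefficients and mean-square convergence\<close>

definition circle_integral :: "(circle \<Rightarrow> 'a::banach) \<Rightarrow> 'a"
  where "circle_integral g = integral {0..2 * pi} (\<lambda>s. g (circle_of s))"

lemma integrable_circle:
  fixes g :: "circle \<Rightarrow> 'a::banach"
  assumes "continuous_on UNIV g"
  shows "(\<lambda>s. g (circle_of s)) integrable_on {0..2 * pi}"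
  using assms unfolding continuous_on_circle_iff
  by (intro integrable_continuous_real) (rule continuous_on_subset, auto)

lemma circle_integral_add:
  "continuous_on UNIV f \<Longrightarrow> continuous_on UNIV g \<Longrightarrow>
    circle_integral (\<lambda>t. f t + g t) = circle_integral f + circle_integral g"
  unfolding circle_integral_def by (intro integral_add integrable_circle)

lemma circle_integral_mult:
  fixes c :: complex
  shows "circle_integral (\<lambda>t. c * g t) = c * circle_integral g"
  unfolding circle_integral_def by simp

lemma circle_integral_mono:
  fixes f g :: "circle \<Rightarrow> real"
  shows "continuous_on UNIV f \<Longrightarrow> continuous_on UNIV g \<Longrightarrow> (\<And>t. f t \<le> g t) \<Longrightarrow>
    circle_integral f \<le> circle_integral g"
  unfolding circle_integral_def by (intro integral_le integrable_circle)

lemma circle_integral_circle_exp: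
  "circle_integral (circle_exp k) = (if k = 0 then 2 * of_real pi else 0)"
proof (cases "k = 0")
  case True
  then show ?thesis
    by (simp add: circle_integral_def scaleR_conv_of_real)
next
  case False
  define F where "F = (\<lambda>s. exp (\<i> * of_int k * of_real s) / (\<i> * of_int k))"
  have "((\<lambda>s. circle_exp k (circle_of s)) has_integral (F (2 * pi) - F 0)) {0..2 * pi}"
  proof (rule fundamental_theorem_of_calculus)
    fix s :: real
    have "((\<lambda>z. exp (\<i> * of_int k * z) / (\<i> * of_int k)) has_field_derivative
        exp (\<i> * of_int k * of_real s)) (at (of_real s))"
      using False by (auto intro!: derivative_eq_intros)
    then have "(F has_vector_derivative exp (\<i> * of_int k * of_real s)) (at s within {0..2 * pi})"
      unfolding F_def by (rule has_vector_derivative_real_field)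
    then show "(F has_vector_derivative circle_exp k (circle_of s)) (at s within {0..2 * pi})"
      by (simp add: circle_exp.abs_eq)
  qed simp
  moreover have "F (2 * pi) = F 0"
    using circle_exp.abs_eq[of k "2 * pi"] circle_exp.abs_eq[of k 0] circle_of_add_period[of 0 1]
    by (simp add: F_def)
  ultimately show ?thesis
    using False by (simp add: circle_integral_def integral_unique)
qed

lemma fourier_coeff_eq:
  "fourier_coeff f k = 1 / (2 * of_real pi) * circle_integral (\<lambda>t. f t * circle_exp (- k) t)"
  by (simp add: fourier_coeff_def circle_integral_def)

lemma fourier_coeff_add:
  assumes "continuous_on UNIV f" "continuous_on UNIV g"
  shows "fourier_coeff (\<lambda>t. f t + g t) k = fourier_coeff f k + fourier_coeff g k"
  unfolding fourier_coeff_eq distrib_right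
  by (subst circle_integral_add)
    (intro continuous_intros assms continuous_circle_exp,
      intro continuous_intros assms continuous_circle_exp, simp add: add_divide_distrib)

lemma fourier_coeff_monomial:
  "fourier_coeff (\<lambda>t. c * circle_exp m t) k = (if k = m then c else 0)"
proof -
  have "(\<lambda>t. c * circle_exp m t * circle_exp (- k) t) = (\<lambda>t. c * circle_exp (m - k) t)"
    by (simp add: circle_exp_add[symmetric] mult.assoc)
  then show ?thesis
    by (simp add: fourier_coeff_eq circle_integral_mult circle_integral_circle_exp)
qed

lemma fourier_coeff_sum_monomials:
  "finite K \<Longrightarrow> fourier_coeff (\<lambda>t. \<Sum>m\<in>K. c m * circle_exp m t) k = (if k \<in> K then c k else 0)"
proof (induction K rule: finite_induct)
  case empty
  show ?case
    by (simp add: fourier_coeff_eq circle_integral_def)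
next
  case (insert m K)
  have "fourier_coeff (\<lambda>t. c m * circle_exp m t + (\<Sum>m\<in>K. c m * circle_exp m t)) k =
      fourier_coeff (\<lambda>t. c m * circle_exp m t) k + fourier_coeff (\<lambda>t. \<Sum>m\<in>K. c m * circle_exp m t) k"
    by (intro fourier_coeff_add continuous_intros continuous_circle_exp)
  with insert show ?case
    by (auto simp: fourier_coeff_monomial)
qed

lemma continuous_fourier_partial_sum: "continuous_on UNIV (fourier_partial_sum n f)"
  unfolding fourier_partial_sum_def by (intro continuous_intros continuous_circle_exp)

lemma fourier_partial_sum_add:
  assumes "continuous_on UNIV f" "continuous_on UNIV g"
  shows "fourier_partial_sum n (\<lambda>t. f t + g t) t = fourier_partial_sum n f t + fourier_partial_sum n g t"
  by (simp add: fourier_partial_sum_def fourier_coeff_add assms distrib_right sum.distrib)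

lemma fourier_partial_sum_trig_polynomial:
  "trig_polynomial p \<Longrightarrow> \<exists>N. \<forall>n\<ge>N. fourier_partial_sum n p = p"
proof (induction rule: trig_polynomial.induct)
  case (monomial c k)
  have "fourier_partial_sum n (\<lambda>t. c * circle_exp k t) t = c * circle_exp k t" if "nat \<bar>k\<bar> \<le> n" for n t
  proof -
    have "fourier_partial_sum n (\<lambda>t. c * circle_exp k t) t =
        (\<Sum>m = - int n..int n. if m = k then c * circle_exp k t else 0)"
      unfolding fourier_partial_sum_def fourier_coeff_monomial by (rule sum.cong) auto
    then show ?thesis
      using that by (auto)
  qed
  then show ?case
    by blast
next
  case (add p q)
  then obtain N M where "\<forall>n\<ge>N. fourier_partial_sum n p = p" "\<forall>n\<ge>M. fourier_partial_sum n q = q"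
    by blast
  then have "\<forall>n\<ge>max N M. fourier_partial_sum n (\<lambda>t. p t + q t) = (\<lambda>t. p t + q t)"
    using add.hyps by (simp add: fun_eq_iff fourier_partial_sum_add continuous_trig_polynomial)
  then show ?case
    by blast
qed

text \<open>The remainder \<open>r = g - s\<close> is orthogonal to every exponential of frequency at most \<open>n\<close>, hence
  to \<open>s\<close> itself, so the square norm of \<open>g = r + s\<close> is the sum of those of \<open>r\<close> and \<open>s\<close>.\<close>

lemma fourier_remainder_le:
  assumes g: "continuous_on UNIV g"
  shows "circle_integral (\<lambda>t. (norm (g t - fourier_partial_sum n g t))\<^sup>2) \<le> circle_integral (\<lambda>t. (norm (g t))\<^sup>2)"
proof -
  define K where "K = {- int n..int n}"
  define s where "s = fourier_partial_sum n g"
  define r where "r = (\<lambda>t. g t - s t)"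
  have s: "continuous_on UNIV s"
    unfolding s_def by (rule continuous_fourier_partial_sum)
  have r: "continuous_on UNIV r"
    unfolding r_def by (intro continuous_intros g s)
  have s_eq: "s = (\<lambda>t. \<Sum>k\<in>K. fourier_coeff g k * circle_exp k t)"
    by (simp add: s_def K_def fourier_partial_sum_def fun_eq_iff)
  have coeff: "circle_integral (\<lambda>t. r t * circle_exp (- k) t) = 0" if "k \<in> K" for k
  proof -
    have "fourier_coeff s k = fourier_coeff g k"
      unfolding s_eq using that by (subst fourier_coeff_sum_monomials) (auto simp: K_def)
    moreover have "fourier_coeff g k = fourier_coeff r k + fourier_coeff s k"
      using fourier_coeff_add[OF r s, of k] by (simp add: r_def)
    ultimately show ?thesis
      by (simp add: fourier_coeff_eq)
  qed
  have "circle_integral (\<lambda>t. r t * cnj (s t)) =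
      circle_integral (\<lambda>t. \<Sum>k\<in>K. cnj (fourier_coeff g k) * (r t * circle_exp (- k) t))"
    by (simp add: s_eq cnj_circle_exp sum_distrib_left mult_ac)
  also have "\<dots> = (\<Sum>k\<in>K. circle_integral (\<lambda>t. cnj (fourier_coeff g k) * (r t * circle_exp (- k) t)))"
    unfolding circle_integral_def
    by (intro integral_sum integrable_circle continuous_intros r continuous_circle_exp)
      (simp add: K_def)
  also have "\<dots> = 0"
    by (simp add: circle_integral_mult coeff)
  finally have orth: "circle_integral (\<lambda>t. r t * cnj (s t)) = 0" .
  have rs: "continuous_on UNIV (\<lambda>t. r t * cnj (s t))"
    by (intro continuous_intros r s)
  have Re0: "circle_integral (\<lambda>t. Re (r t * cnj (s t))) = 0"
    using integral_linear[OF integrable_circle[OF rs] bounded_linear_Re] orth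
    by (simp add: circle_integral_def o_def)
  \<comment> \<open>The cross term integrates to 0; adding it here makes the comparison with \<open>g\<close> pointwise.\<close>
  have "circle_integral (\<lambda>t. (norm (r t))\<^sup>2) =
      circle_integral (\<lambda>t. (norm (r t))\<^sup>2 + (Re (r t * cnj (s t)) + Re (r t * cnj (s t))))"
    using Re0 by (subst circle_integral_add circle_integral_add; (intro continuous_intros r s)?)+ simp
  also have "\<dots> \<le> circle_integral (\<lambda>t. (norm (g t))\<^sup>2)"
  proof (rule circle_integral_mono)
    fix t
    have "(norm (r t + s t))\<^sup>2 = (norm (r t))\<^sup>2 + (norm (s t))\<^sup>2 + 2 * Re (r t * cnj (s t))"
      by (simp only: cmod_power2) (simp add: power2_eq_square algebra_simps)
    then show "(norm (r t))\<^sup>2 + (Re (r t * cnj (s t)) + Re (r t * cnj (s t))) \<le> (norm (g t))\<^sup>2"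
      by (simp add: r_def)
  qed (intro continuous_intros r s g)+
  finally show ?thesis
    by (simp add: r_def s_def)
qed

lemma fourier_mean_square_convergence:
  assumes f: "continuous_on UNIV f"
  shows "(\<lambda>n. circle_integral (\<lambda>t. (norm (f t - fourier_partial_sum n f t))\<^sup>2)) \<longlonglongrightarrow> 0"
proof (rule LIMSEQ_I)
  fix e :: real
  assume "0 < e"
  \<comment> \<open>A uniform error below \<open>d\<close> costs at most \<open>2 * pi * d\<^sup>2 = e / 2\<close> in the integral.\<close>
  define d where "d = sqrt (e / (4 * pi))"
  have "0 < d"
    using \<open>0 < e\<close> by (simp add: d_def)
  then obtain p where p: "trig_polynomial p" and fp: "\<And>t. norm (f t - p t) < d"
    using trig_polynomial_approx[OF f] by blast
  obtain N where N: "\<And>n. n \<ge> N \<Longrightarrow> fourier_partial_sum n p = p"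
    using fourier_partial_sum_trig_polynomial[OF p] by blast
  have cp: "continuous_on UNIV p"
    by (rule continuous_trig_polynomial[OF p])
  define g where "g = (\<lambda>t. f t - p t)"
  have g: "continuous_on UNIV g"
    unfolding g_def by (intro continuous_intros f cp)
  have "norm (circle_integral (\<lambda>t. (norm (f t - fourier_partial_sum n f t))\<^sup>2) - 0) < e" if "n \<ge> N" for n
  proof -
    have "fourier_partial_sum n f t = fourier_partial_sum n g t + p t" for t
      using fourier_partial_sum_add[OF g cp, of n t] N[OF that] by (simp add: g_def)
    then have "f t - fourier_partial_sum n f t = g t - fourier_partial_sum n g t" for t
      by (simp add: g_def)
    then have "circle_integral (\<lambda>t. (norm (f t - fourier_partial_sum n f t))\<^sup>2) \<le>
        circle_integral (\<lambda>t. (norm (g t))\<^sup>2)"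
      using fourier_remainder_le[OF g] by simp
    also have "\<dots> \<le> circle_integral (\<lambda>t. d\<^sup>2)"
      using fp g by (intro circle_integral_mono continuous_intros power_mono)
        (auto simp: g_def less_imp_le)
    also have "\<dots> = e / 2"
      using \<open>0 < e\<close> by (simp add: circle_integral_def d_def)
    also have "\<dots> < e"
      using \<open>0 < e\<close> by simp
    finally have "circle_integral (\<lambda>t. (norm (f t - fourier_partial_sum n f t))\<^sup>2) < e" .
    moreover have "circle_integral (\<lambda>t. 0) \<le> circle_integral (\<lambda>t. (norm (f t - fourier_partial_sum n f t))\<^sup>2)"
      by (intro circle_integral_mono continuous_intros f continuous_fourier_partial_sum) simp
    ultimately show ?thesis
      by (simp add: circle_integral_def)
  qed
  then show "\<exists>N. \<forall>n\<ge>N. norm (circle_integral (\<lambda>t. (norm (f t - fourier_partial_sum n f t))\<^sup>2) - 0) < e"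
    by blast
qed

section \<open>Nowhere density of the exceptional sets\<close>

text \<open>The arc is taken inside the fundamental domain, where \<open>circle_integral\<close> sees it.\<close>

lemma open_circle_contains_arc:
  assumes "open U" "U \<noteq> {}"
  obtains a b where "0 \<le> a" "a < b" "b \<le> 2 * pi" "\<And>s. s \<in> {a..b} \<Longrightarrow> circle_of s \<in> U"
proof -
  obtain t where "t \<in> U"
    using \<open>U \<noteq> {}\<close> by blast
  moreover obtain x where "t = circle_of x"
    by (rule circle_of_cases)
  moreover obtain a where "circle_of a = circle_of x" "0 \<le> a" "a < 2 * pi"
    by (rule circle_of_shift)
  ultimately have a: "circle_of a \<in> U" "0 \<le> a" "a < 2 * pi"
    by simp_all
  have "open (circle_of -` U)"
    using \<open>open U\<close> by (simp add: open_circle_def)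
  then obtain e where e: "e > 0" "cball a e \<subseteq> circle_of -` U"
    using a(1) unfolding open_contains_cball by blast
  show ?thesis
  proof
    show "0 \<le> a" "a < min (a + e) (2 * pi)" "min (a + e) (2 * pi) \<le> 2 * pi"
      using a e by auto
    show "circle_of s \<in> U" if "s \<in> {a..min (a + e) (2 * pi)}" for s
      using e(2) that by (auto simp: dist_real_def subset_eq)
  qed
qed

text \<open>On an arc inside \<open>C\<close> of length \<open>b - a\<close> the mean square error along the subsequence would
  be at least \<open>(b - a) * d\<^sup>2\<close> from \<open>N\<close> on, contrary to its convergence to 0.\<close>

lemma nowhere_dense_subsequence_bad:
  fixes N :: nat
  assumes f: "continuous_on UNIV f" and n: "strict_mono n" and d: "0 < d"
  defines "C \<equiv> {t. \<forall>j\<ge>N. d \<le> norm (f t - fourier_partial_sum (n j) f t)}"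
  shows "nowhere_dense C"
proof -
  have "C = (\<Inter>j\<in>{N..}. {t. d \<le> norm (f t - fourier_partial_sum (n j) f t)})"
    by (auto simp: C_def)
  moreover have "closed {t. d \<le> norm (f t - fourier_partial_sum (n j) f t)}" for j
    by (intro closed_Collect_le continuous_intros f continuous_fourier_partial_sum)
  ultimately have "closed C"
    by auto
  moreover have "interior C = {}"
  proof (rule ccontr)
    assume "interior C \<noteq> {}"
    then obtain a b where ab: "0 \<le> a" "a < b" "b \<le> 2 * pi" "\<And>s. s \<in> {a..b} \<Longrightarrow> circle_of s \<in> interior C"
      using open_circle_contains_arc[OF open_interior] by metis
    let ?I = "\<lambda>m. circle_integral (\<lambda>t. (norm (f t - fourier_partial_sum m f t))\<^sup>2)"
    have "(b - a) * d\<^sup>2 \<le> ?I (n j)" if "j \<ge> N" for j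
    proof -
      let ?g = "\<lambda>t. (norm (f t - fourier_partial_sum (n j) f t))\<^sup>2"
      have g: "(\<lambda>s. ?g (circle_of s)) integrable_on {0..2 * pi}"
        by (intro integrable_circle continuous_intros f continuous_fourier_partial_sum)
      then have g': "(\<lambda>s. ?g (circle_of s)) integrable_on {a..b}"
        by (rule integrable_on_subinterval) (use ab in auto)
      have "d\<^sup>2 \<le> ?g (circle_of s)" if "s \<in> {a..b}" for s
        using ab(4)[OF that] interior_subset[of C] \<open>j \<ge> N\<close> d
        by (intro power_mono) (auto simp: C_def)
      then have "integral {a..b} (\<lambda>s. d\<^sup>2) \<le> integral {a..b} (\<lambda>s. ?g (circle_of s))"
        by (intro integral_le g') auto
      also have "\<dots> \<le> integral {0..2 * pi} (\<lambda>s. ?g (circle_of s))"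
        by (rule integral_subset_le) (use ab g g' in auto)
      finally show ?thesis
        using ab by (simp add: circle_integral_def)
    qed
    moreover have "(\<lambda>j. ?I (n j)) \<longlonglongrightarrow> 0"
      using LIMSEQ_subseq_LIMSEQ[OF fourier_mean_square_convergence[OF f] n] by (simp add: o_def)
    ultimately have "(b - a) * d\<^sup>2 \<le> 0"
      by (intro LIMSEQ_le_const) auto
    moreover have "0 < (b - a) * d\<^sup>2"
      using ab d by simp
    ultimately show False
      by simp
  qed
  ultimately show ?thesis
    by (simp add: nowhere_dense_def)
qed

lemma nowhere_dense_subset: "nowhere_dense T \<Longrightarrow> S \<subseteq> T \<Longrightarrow> nowhere_dense S"
  unfolding nowhere_dense_def by (metis closure_mono interior_mono subset_empty)

theorem mainTheorem3:
  fixes f :: "circle \<Rightarrow> complex"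
    and n :: "nat \<Rightarrow> nat"
    and A :: "circle set"
    and h :: "circle \<Rightarrow> complex"
  assumes "continuous_on UNIV f"
    and "strict_mono n"
    and "\<forall>t\<in>A. (\<lambda>j. fourier_partial_sum (n j) f t) \<longlonglongrightarrow> h t"
  shows "first_category {t \<in> A. h t \<noteq> f t}"
proof -
  define E where "E = {t \<in> A. h t \<noteq> f t}"
  define C where "C = (\<lambda>(m::nat, N).
    {t. \<forall>j\<ge>N. inverse (real (Suc m)) \<le> norm (f t - fourier_partial_sum (n j) f t)})"
  \<comment> \<open>The sets are cut down to \<open>E\<close> because \<open>first_category\<close> asks for a union equal to \<open>E\<close>.\<close>
  have "nowhere_dense (E \<inter> C z)" for z
    unfolding C_def using nowhere_dense_subsequence_bad[OF assms(1,2)]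
    by (cases z) (auto intro!: nowhere_dense_subset[OF _ Int_lower2])
  moreover have "E \<subseteq> (\<Union>z. E \<inter> C z)"
  proof
    fix t
    assume t: "t \<in> E"
    then have "0 < norm (f t - h t)"
      by (auto simp: E_def)
    then obtain m where m: "inverse (real (Suc m)) < norm (f t - h t)"
      using reals_Archimedean by blast
    have "(\<lambda>j. norm (f t - fourier_partial_sum (n j) f t)) \<longlonglongrightarrow> norm (f t - h t)"
      using t assms(3) by (intro tendsto_intros) (auto simp: E_def)
    then have "\<forall>\<^sub>F j in sequentially. inverse (real (Suc m)) < norm (f t - fourier_partial_sum (n j) f t)"
      using m by (rule order_tendstoD)
    then obtain N where "\<forall>j\<ge>N. inverse (real (Suc m)) < norm (f t - fourier_partial_sum (n j) f t)"
      unfolding eventually_sequentially by blast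
    then have "t \<in> C (m, N)"
      by (auto simp: C_def less_imp_le)
    with t show "t \<in> (\<Union>z. E \<inter> C z)"
      by blast
  qed
  ultimately have "first_category E"
    unfolding first_category_def by (intro exI[of _ "range (\<lambda>z. E \<inter> C z)"]) auto
  then show ?thesis
    by (simp add: E_def)
qed

end
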